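(* Let $\Delta t>0$ be arbitrary, let $S>0$ be a stabilizing parameter, and let $(\phi^n,q^n)_{n\ge0}$ and $(\mu^{n+1/2})_{n\ge0}$ satisfy, for every $n\ge0$, the stabilized IEQ Crank--Nicolson scheme $$\frac{\phi^{n+1}-\phi^{n}}{\Delta t}=\mathcal{G}\mu^{n+1/2},$$ $$\mu^{n+1/2}=\mathcal{L}\left(\frac{\phi^{n+1}+\phi^n}{2}\right)+S(\phi^{n+1}-\phi^{n})+\frac{q^{n+1}+q^n}{2\sqrt{F(\tilde{\phi}^{n+1/2})+C}}F'(\tilde{\phi}^{n+1/2}),$$ $$\frac{q^{n+1}-q^n}{\Delta t}=\frac{F'(\tilde{\phi}^{n+1/2})}{2\sqrt{F(\tilde{\phi}^{n+1/2})+C}}\,\frac{\phi^{n+1}-\phi^{n}}{\Delta t}.$$ Define $$E_{SIEQ-CN}^{n}=\frac12(\mathcal{L}\phi^{n},\phi^{n})+\|q^{n}\|^2 .$$ Then the scheme is unconditionally energy stable in the sense that, for every $n\ge0$, $$E_{SIEQ-CN}^{n+1}-E^{n}_{SIEQ-CN}\leq\Delta t\,(\mathcal{G}\mu^{n+1/2},\mu^{n+1/2})\leq0 .$$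
   Context: $(\cdot,\cdot)$ and $\|\cdot\|$ are the $L^2(\Omega)$ inner product and norm over real-valued functions on a domain $\Omega$. The phase field model is $\partial\phi/\partial t=\mathcal{G}\mu$, where $\mathcal{L}$ is a symmetric non-negative linear operator and $\mathcal{G}$ is a non-positive linear operator on $L^2(\Omega)$, i.e. $(\mathcal{L}v,w)=(v,\mathcal{L}w)$, $(\mathcal{L}v,v)\ge 0$ and $(\mathcal{G}v,v)\le 0$. $F$ is the (real, differentiable) nonlinear energy density, assumed bounded from below, and $C>0$ is a constant with $F(\phi)+C>0$ for all real $\phi$. Functions of $\phi$ are applied pointwise on $\Omega$. The scheme is semi-discrete (discrete in time only): $\phi^n,q^n,\mu^{n+1/2}$ are real-valued functions on $\Omega$, regular enough for all expressions to make sense. The unknown $q$ approximates $\sqrt{F(\phi)+C}$, with $q^0=\sqrt{F(\phi^0)+C}$. Here $\tilde\phi^{n+1/2}$ is any explicit $O(\Delta t^2)$ approximation of $\phi(t^{n+1/2})$ (a real-valued function on $\Omega$ computed from earlier time levels). "Unconditionally" means with no restriction on $\Delta t>0$. *)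

theory Defs
  imports "HOL-Analysis.Analysis"
begin

text \<open>
  Elements of \<open>L\<^sup>2(\<Omega>)\<close> are represented by functions; only their values on \<open>\<Omega>\<close>
  matter, and functions that agree almost everywhere on \<open>\<Omega>\<close> are identified.
\<close>

definition ae_eq :: "'a::euclidean_space set \<Rightarrow> ('a \<Rightarrow> real) \<Rightarrow> ('a \<Rightarrow> real) \<Rightarrow> bool" where
  "ae_eq \<Omega> f g \<longleftrightarrow> (AE x in lebesgue_on \<Omega>. f x = g x)"

definition L2 :: "'a::euclidean_space set \<Rightarrow> ('a \<Rightarrow> real) set" where
  "L2 \<Omega> = {f \<in> borel_measurable (lebesgue_on \<Omega>). integrable (lebesgue_on \<Omega>) (\<lambda>x. (f x)\<^sup>2)}"

definition L2_inner :: "'a::euclidean_space set \<Rightarrow> ('a \<Rightarrow> real) \<Rightarrow> ('a \<Rightarrow> real) \<Rightarrow> real" where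
  "L2_inner \<Omega> f g = (\<integral>x. f x * g x \<partial>lebesgue_on \<Omega>)"

definition L2_norm :: "'a::euclidean_space set \<Rightarrow> ('a \<Rightarrow> real) \<Rightarrow> real" where
  "L2_norm \<Omega> f = sqrt (L2_inner \<Omega> f f)"

text \<open>
  A linear operator \<open>A\<close> on \<open>L\<^sup>2(\<Omega>)\<close> with domain of definition \<open>D\<close>. The domain may be a proper
  subspace, since an everywhere defined symmetric operator is bounded and differential
  operators such as the Laplacian would be excluded. \<open>D\<close> and \<open>A\<close> are compatible with
  equality almost everywhere, so that they descend to equivalence classes.
\<close>

definition L2_operator ::
  "'a::euclidean_space set \<Rightarrow> ('a \<Rightarrow> real) set \<Rightarrow> (('a \<Rightarrow> real) \<Rightarrow> ('a \<Rightarrow> real)) \<Rightarrow> bool" where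
  "L2_operator \<Omega> D A \<longleftrightarrow>
     D \<subseteq> L2 \<Omega> \<and> (\<lambda>x. 0) \<in> D \<and>
     (\<forall>v\<in>D. \<forall>w\<in>D. (\<lambda>x. v x + w x) \<in> D) \<and>
     (\<forall>c. \<forall>v\<in>D. (\<lambda>x. c * v x) \<in> D) \<and>
     (\<forall>v\<in>D. \<forall>w\<in>L2 \<Omega>. ae_eq \<Omega> v w \<longrightarrow> w \<in> D) \<and>
     (\<forall>v\<in>D. A v \<in> L2 \<Omega>) \<and>
     (\<forall>v\<in>D. \<forall>w\<in>D. ae_eq \<Omega> v w \<longrightarrow> ae_eq \<Omega> (A v) (A w)) \<and>
     (\<forall>v\<in>D. \<forall>w\<in>D. ae_eq \<Omega> (A (\<lambda>x. v x + w x)) (\<lambda>x. A v x + A w x)) \<and>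
     (\<forall>c. \<forall>v\<in>D. ae_eq \<Omega> (A (\<lambda>x. c * v x)) (\<lambda>x. c * A v x))"

definition L2_symmetric ::
  "'a::euclidean_space set \<Rightarrow> ('a \<Rightarrow> real) set \<Rightarrow> (('a \<Rightarrow> real) \<Rightarrow> ('a \<Rightarrow> real)) \<Rightarrow> bool" where
  "L2_symmetric \<Omega> D A \<longleftrightarrow> (\<forall>v\<in>D. \<forall>w\<in>D. L2_inner \<Omega> (A v) w = L2_inner \<Omega> v (A w))"

definition L2_nonneg ::
  "'a::euclidean_space set \<Rightarrow> ('a \<Rightarrow> real) set \<Rightarrow> (('a \<Rightarrow> real) \<Rightarrow> ('a \<Rightarrow> real)) \<Rightarrow> bool" where
  "L2_nonneg \<Omega> D A \<longleftrightarrow> (\<forall>v\<in>D. L2_inner \<Omega> (A v) v \<ge> 0)"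

definition L2_nonpos ::
  "'a::euclidean_space set \<Rightarrow> ('a \<Rightarrow> real) set \<Rightarrow> (('a \<Rightarrow> real) \<Rightarrow> ('a \<Rightarrow> real)) \<Rightarrow> bool" where
  "L2_nonpos \<Omega> D A \<longleftrightarrow> (\<forall>v\<in>D. L2_inner \<Omega> (A v) v \<le> 0)"

definition E_SIEQ_CN ::
  "'a::euclidean_space set \<Rightarrow> (('a \<Rightarrow> real) \<Rightarrow> ('a \<Rightarrow> real)) \<Rightarrow> ('a \<Rightarrow> real) \<Rightarrow> ('a \<Rightarrow> real) \<Rightarrow> real" where
  "E_SIEQ_CN \<Omega> L u p = 1 / 2 * L2_inner \<Omega> (L u) u + (L2_norm \<Omega> p)\<^sup>2"

text \<open>
  The levels \<open>0, \<dots>, n\<close> of a sequence of pairs \<open>(\<phi>, q)\<close>. An explicit approximation at the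
  half level \<open>n + 1/2\<close> is a function of this list alone.
\<close>

definition history :: "(nat \<Rightarrow> 'b) \<Rightarrow> (nat \<Rightarrow> 'c) \<Rightarrow> nat \<Rightarrow> ('b \<times> 'c) list" where
  "history \<phi> q n = map (\<lambda>k. (\<phi> k, q k)) [0..<Suc n]"

end

theory Submission
  imports Defs
begin

text \<open>
  Pair the equation for \<open>\<mu>\<close> with \<open>\<phi>\<^sup>n\<^sup>+\<^sup>1 - \<phi>\<^sup>n = \<Delta>t G \<mu>\<close>. Since \<open>L\<close> is symmetric, the \<open>L\<close>-term
  is the increment of the quadratic part of the energy; by the equation for \<open>q\<close>, the nonlinear
  term is pointwise \<open>(q\<^sup>n\<^sup>+\<^sup>1)\<^sup>2 - (q\<^sup>n)\<^sup>2\<close>. What remains is the dissipation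
  \<open>S \<parallel>\<phi>\<^sup>n\<^sup>+\<^sup>1 - \<phi>\<^sup>n\<parallel>\<^sup>2 \<ge> 0\<close>.
\<close>

text \<open>Domination by \<open>2 * \<bar>a * b\<bar> \<le> a\<^sup>2 + b\<^sup>2\<close>. This
  makes each inner product of \<open>L2\<close> functions a genuine integral, so the energy balance
  may be split term by term.\<close>

lemma L2_integrable_mult:
  assumes "f \<in> L2 \<Omega>" "g \<in> L2 \<Omega>"
  shows "integrable (lebesgue_on \<Omega>) (\<lambda>x. f x * g x)"
proof (rule Bochner_Integration.integrable_bound)
  show "integrable (lebesgue_on \<Omega>) (\<lambda>x. (f x)\<^sup>2 + (g x)\<^sup>2)"
    using assms by (auto simp: L2_def)
  show "(\<lambda>x. f x * g x) \<in> borel_measurable (lebesgue_on \<Omega>)"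
    using assms by (auto simp: L2_def)
  have "\<bar>a * b\<bar> \<le> \<bar>a\<^sup>2 + b\<^sup>2\<bar>" for a b :: real
  proof -
    have "2 * (\<bar>a\<bar> * \<bar>b\<bar>) \<le> a\<^sup>2 + b\<^sup>2"
      using sum_squares_bound[of "\<bar>a\<bar>" "\<bar>b\<bar>"] by (simp add: mult.assoc)
    moreover have "0 \<le> \<bar>a\<bar> * \<bar>b\<bar>" by simp
    ultimately show ?thesis unfolding abs_mult by linarith
  qed
  then show "AE x in lebesgue_on \<Omega>. norm (f x * g x) \<le> norm ((f x)\<^sup>2 + (g x)\<^sup>2)"
    by simp
qed

lemma L2_inner_commute: "L2_inner \<Omega> f g = L2_inner \<Omega> g f"
  by (simp add: L2_inner_def mult.commute)

lemma L2_inner_nonneg: "0 \<le> L2_inner \<Omega> f f"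
  by (simp add: L2_inner_def)

lemma L2_norm_power2: "(L2_norm \<Omega> f)\<^sup>2 = L2_inner \<Omega> f f"
  by (simp add: L2_norm_def L2_inner_nonneg)

lemma L2_operator_in_L2:
  assumes A: "L2_operator \<Omega> D A" and v: "v \<in> D"
  shows "v \<in> L2 \<Omega>" "A v \<in> L2 \<Omega>"
proof -
  have "D \<subseteq> L2 \<Omega>" "\<forall>v\<in>D. A v \<in> L2 \<Omega>"
    using A unfolding L2_operator_def by - (elim conjE, assumption)+
  with v show "v \<in> L2 \<Omega>" "A v \<in> L2 \<Omega>" by auto
qed

text \<open>Linearity holds only almost everywhere, so homogeneity with factor \<open>1/2\<close> is
  applied to the sum, which lies in \<open>D\<close> by closure, and the exceptional null sets of
  scaling and addition are then merged.\<close>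

lemma L2_operator_average:
  assumes A: "L2_operator \<Omega> D A" and v: "v \<in> D" and w: "w \<in> D"
  shows "AE x in lebesgue_on \<Omega>. A (\<lambda>y. (v y + w y) / 2) x = (A v x + A w x) / 2"
proof -
  have closed: "\<forall>v\<in>D. \<forall>w\<in>D. (\<lambda>x. v x + w x) \<in> D"
    and add: "\<forall>v\<in>D. \<forall>w\<in>D. ae_eq \<Omega> (A (\<lambda>x. v x + w x)) (\<lambda>x. A v x + A w x)"
    and scale: "\<forall>c. \<forall>v\<in>D. ae_eq \<Omega> (A (\<lambda>x. c * v x)) (\<lambda>x. c * A v x)"
    using A unfolding L2_operator_def by - (elim conjE, assumption)+
  have "ae_eq \<Omega> (A (\<lambda>x. (1/2) * (v x + w x))) (\<lambda>x. (1/2) * A (\<lambda>x. v x + w x) x)"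
    using scale[rule_format, OF closed[rule_format, OF v w], of "1/2"] .
  with add[rule_format, OF v w] show ?thesis
    unfolding ae_eq_def by eventually_elim simp
qed

theorem theorem4p1:
  fixes \<Omega> :: "'a::euclidean_space set"
    and L G :: "('a \<Rightarrow> real) \<Rightarrow> ('a \<Rightarrow> real)"
    and DL DG :: "('a \<Rightarrow> real) set"
    and F :: "real \<Rightarrow> real"
    and C S dt :: real
    and \<phi> q \<mu> \<phi>t :: "nat \<Rightarrow> 'a \<Rightarrow> real"
    and extrap :: "(('a \<Rightarrow> real) \<times> ('a \<Rightarrow> real)) list \<Rightarrow> 'a \<Rightarrow> real"
  assumes domain: "open \<Omega>" "connected \<Omega>" "\<Omega> \<noteq> {}"
    and L_op: "L2_operator \<Omega> DL L" "L2_symmetric \<Omega> DL L" "L2_nonneg \<Omega> DL L"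
    and G_op: "L2_operator \<Omega> DG G" "L2_nonpos \<Omega> DG G"
    and F_diff: "\<And>s. F differentiable (at s)"
    and F_bdd: "bdd_below (range F)"
    and C_pos: "C > 0" "\<And>s. F s + C > 0"
    and dt_pos: "dt > 0"
    and S_pos: "S > 0"
    and regularity: "\<And>n. \<phi> n \<in> DL" "\<And>n. q n \<in> L2 \<Omega>" "\<And>n. \<mu> n \<in> DG"
    and q_init: "AE x in lebesgue_on \<Omega>. q 0 x = sqrt (F (\<phi> 0 x) + C)"
    and explicit: "\<And>n. \<phi>t n = extrap (history \<phi> q n)"
    and scheme_phi: "\<And>n. AE x in lebesgue_on \<Omega>.
          (\<phi> (Suc n) x - \<phi> n x) / dt = G (\<mu> n) x"
    and scheme_mu: "\<And>n. AE x in lebesgue_on \<Omega>.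
          \<mu> n x = L (\<lambda>y. (\<phi> (Suc n) y + \<phi> n y) / 2) x
                  + S * (\<phi> (Suc n) x - \<phi> n x)
                  + (q (Suc n) x + q n x) / (2 * sqrt (F (\<phi>t n x) + C)) * deriv F (\<phi>t n x)"
    and scheme_q: "\<And>n. AE x in lebesgue_on \<Omega>.
          (q (Suc n) x - q n x) / dt
            = deriv F (\<phi>t n x) / (2 * sqrt (F (\<phi>t n x) + C)) * ((\<phi> (Suc n) x - \<phi> n x) / dt)"
  shows "\<forall>n. E_SIEQ_CN \<Omega> L (\<phi> (Suc n)) (q (Suc n)) - E_SIEQ_CN \<Omega> L (\<phi> n) (q n)
               \<le> dt * L2_inner \<Omega> (G (\<mu> n)) (\<mu> n)
           \<and> dt * L2_inner \<Omega> (G (\<mu> n)) (\<mu> n) \<le> 0"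
proof
  fix n
  define d where "d = (\<lambda>x. \<phi> (Suc n) x - \<phi> n x)"
  note L2 = L2_operator_in_L2[OF L_op(1) regularity(1)] L2_operator_in_L2[OF G_op(1) regularity(3)]
    regularity(2)
  \<comment> \<open>The time levels stay schematic and independent, so these facts also cover
    products that mix level \<open>n\<close> with level \<open>Suc n\<close>.\<close>
  note int = L2_integrable_mult[OF L2(2) L2(1)] L2_integrable_mult[OF L2(1) L2(1)]
    L2_integrable_mult[OF L2(5) L2(5)]
  have dd: "(\<lambda>x. d x * d x) = (\<lambda>x. \<phi> (Suc n) x * \<phi> (Suc n) x
      - 2 * (\<phi> (Suc n) x * \<phi> n x) + \<phi> n x * \<phi> n x)"
    by (simp add: d_def fun_eq_iff algebra_simps)
  have int_d: "integrable (lebesgue_on \<Omega>) (\<lambda>x. d x * d x)"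
    unfolding dd by (intro Bochner_Integration.integrable_add Bochner_Integration.integrable_diff
        integrable_mult_right int)
  have sym: "L2_inner \<Omega> (L (\<phi> n)) (\<phi> (Suc n)) = L2_inner \<Omega> (L (\<phi> (Suc n))) (\<phi> n)"
    using L_op(2) regularity(1)[of n] regularity(1)[of "Suc n"]
    by (subst L2_inner_commute) (simp add: L2_symmetric_def)
  \<comment> \<open>\<open>?R\<close> is the expanded integrand of the energy balance. It contains
    no \<open>F\<close>: every summand is a multiple of a product of \<open>L2\<close> functions, so
    no integrability of the nonlinear term by itself has to be known.\<close>
  let ?R = "\<lambda>x. 1/2 * (L (\<phi> (Suc n)) x * \<phi> (Suc n) x + L (\<phi> n) x * \<phi> (Suc n) x
      - L (\<phi> (Suc n)) x * \<phi> n x - L (\<phi> n) x * \<phi> n x) + S * (d x * d x)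
      + q (Suc n) x * q (Suc n) x - q n x * q n x"
  have int_R: "has_bochner_integral (lebesgue_on \<Omega>) ?R
     (1/2 * (L2_inner \<Omega> (L (\<phi> (Suc n))) (\<phi> (Suc n)) + L2_inner \<Omega> (L (\<phi> n)) (\<phi> (Suc n))
      - L2_inner \<Omega> (L (\<phi> (Suc n))) (\<phi> n) - L2_inner \<Omega> (L (\<phi> n)) (\<phi> n)) + S * L2_inner \<Omega> d d
      + L2_inner \<Omega> (q (Suc n)) (q (Suc n)) - L2_inner \<Omega> (q n) (q n))"
    unfolding L2_inner_def
    by (intro has_bochner_integral_add has_bochner_integral_diff has_bochner_integral_mult_right
        has_bochner_integral_integrable int int_d)
  have ae: "AE x in lebesgue_on \<Omega>. dt * (G (\<mu> n) x * \<mu> n x) = ?R x"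
    using scheme_phi[of n] scheme_mu[of n] scheme_q[of n]
      L2_operator_average[OF L_op(1) regularity(1)[of "Suc n"] regularity(1)[of n]]
  proof eventually_elim
    case (elim x)
    \<comment> \<open>The same coefficient \<open>h\<close> multiplies the average of
      \<open>q\<close> in the equation for \<open>\<mu>\<close> and the increment \<open>d\<close>
      in the equation for \<open>q\<close>; this match is what makes the nonlinear term
      exact.\<close>
    define h where "h = deriv F (\<phi>t n x) / (2 * sqrt (F (\<phi>t n x) + C))"
    have G: "dt * G (\<mu> n) x = d x"
      using elim(1) dt_pos by (simp add: d_def field_simps)
    have q: "q (Suc n) x - q n x = h * d x"
      using elim(3) dt_pos unfolding h_def[symmetric] d_def by (simp add: field_simps)
    have \<mu>: "\<mu> n x = (L (\<phi> (Suc n)) x + L (\<phi> n) x) / 2 + S * d x + (q (Suc n) x + q n x) * h"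
      using elim(2,4) by (simp add: d_def h_def)
    have "dt * (G (\<mu> n) x * \<mu> n x) = d x * \<mu> n x"
      by (simp flip: G)
    also have "\<dots> = d x * ((L (\<phi> (Suc n)) x + L (\<phi> n) x) / 2) + S * (d x * d x)
        + (q (Suc n) x + q n x) * (h * d x)"
      unfolding \<mu> by (simp add: algebra_simps)
    \<comment> \<open>Replacing \<open>h * d x\<close> by the increment of \<open>q\<close> gives
      sum times difference, hence a difference of squares.\<close>
    also have "\<dots> = ?R x"
      unfolding q[symmetric] by (simp add: d_def field_simps)
    finally show ?case .
  qed
  have "dt * L2_inner \<Omega> (G (\<mu> n)) (\<mu> n) = (\<integral>x. dt * (G (\<mu> n) x * \<mu> n x) \<partial>lebesgue_on \<Omega>)"
    by (simp add: L2_inner_def)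
  \<comment> \<open>Passing from almost everywhere equality to equal integrals requires both
    integrands measurable; here each is so because it is integrable.\<close>
  also have "\<dots> = (\<integral>x. ?R x \<partial>lebesgue_on \<Omega>)"
    by (intro integral_cong_AE borel_measurable_integrable integrable_mult_right
        L2_integrable_mult L2 integrable.intros[OF int_R] ae)
  also have "\<dots> = 1/2 * (L2_inner \<Omega> (L (\<phi> (Suc n))) (\<phi> (Suc n)) + L2_inner \<Omega> (L (\<phi> n)) (\<phi> (Suc n))
      - L2_inner \<Omega> (L (\<phi> (Suc n))) (\<phi> n) - L2_inner \<Omega> (L (\<phi> n)) (\<phi> n)) + S * L2_inner \<Omega> d d
      + L2_inner \<Omega> (q (Suc n)) (q (Suc n)) - L2_inner \<Omega> (q n) (q n)"
    by (rule has_bochner_integral_integral_eq[OF int_R])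
  \<comment> \<open>By \<open>sym\<close> the two mixed terms cancel, leaving the exact energy
    identity with the stabilization term as the only surplus.\<close>
  finally have "dt * L2_inner \<Omega> (G (\<mu> n)) (\<mu> n)
      = E_SIEQ_CN \<Omega> L (\<phi> (Suc n)) (q (Suc n)) - E_SIEQ_CN \<Omega> L (\<phi> n) (q n) + S * L2_inner \<Omega> d d"
    unfolding E_SIEQ_CN_def L2_norm_power2 sym by (simp add: algebra_simps)
  moreover have "0 \<le> S * L2_inner \<Omega> d d"
    using S_pos L2_inner_nonneg[of \<Omega> d] by simp
  moreover have "dt * L2_inner \<Omega> (G (\<mu> n)) (\<mu> n) \<le> 0"
    using G_op(2) regularity(3) dt_pos by (simp add: L2_nonpos_def mult_nonneg_nonpos)
  ultimately show "E_SIEQ_CN \<Omega> L (\<phi> (Suc n)) (q (Suc n)) - E_SIEQ_CN \<Omega> L (\<phi> n) (q n)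
               \<le> dt * L2_inner \<Omega> (G (\<mu> n)) (\<mu> n)
           \<and> dt * L2_inner \<Omega> (G (\<mu> n)) (\<mu> n) \<le> 0"
    by linarith
qed

end
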